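(* Let $(D,\sqsubseteq)$ be a finite partial ordering with least element $\bot$ and greatest element $\top$, and let $F$ be a finite set of functions $D\to D$, each of which is inflationary and monotonic. Consider the Generic Iteration Algorithm (GI) described in the context, where for all $G,g,d$ the set $\mathit{update}(G,g,d)\subseteq F$ satisfies conditions A, B and C. Then every execution of GI terminates, and upon termination the variable $d$ equals the least common fixpoint of the functions in $F$.
   Context: A function $f:D\to D$ is inflationary if $x\sqsubseteq f(x)$ for all $x$, and monotonic if $x\sqsubseteq y$ implies $f(x)\sqsubseteq f(y)$. Generic Iteration Algorithm (GI): $d:=\bot$; $G:=F$; while $G\neq\emptyset$ and $d\neq\top$ do: choose $g\in G$; $G:=G-\{g\}$; $G:=G\cup \mathit{update}(G,g,d)$; $d:=g(d)$; end. Here, for all $G\subseteq F$, $g\in F$ and $d\in D$, $\mathit{update}(G,g,d)$ is a subset of $F$ such that: (A) $\{f\in F-G \mid f(d)=d \wedge f(g(d))\neq g(d)\}\subseteq \mathit{update}(G,g,d)$; (B) $g(d)=d$ implies $\mathit{update}(G,g,d)=\emptyset$; (C) $g(g(d))\neq g(d)$ implies $g\in\mathit{update}(G,g,d)$. *)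

theory Defs
  imports Main
begin

definition inflationary :: "('a::order \<Rightarrow> 'a) \<Rightarrow> bool" where
  "inflationary f \<longleftrightarrow> (\<forall>x. x \<le> f x)"

definition common_fixpoint :: "('a \<Rightarrow> 'a) set \<Rightarrow> 'a \<Rightarrow> bool" where
  "common_fixpoint F x \<longleftrightarrow> (\<forall>f\<in>F. f x = x)"

definition least_common_fixpoint :: "('a::order \<Rightarrow> 'a) set \<Rightarrow> 'a \<Rightarrow> bool" where
  "least_common_fixpoint F x \<longleftrightarrow>
     common_fixpoint F x \<and> (\<forall>y. common_fixpoint F y \<longrightarrow> x \<le> y)"

type_synonym 'a update = "('a \<Rightarrow> 'a) set \<Rightarrow> ('a \<Rightarrow> 'a) \<Rightarrow> 'a \<Rightarrow> ('a \<Rightarrow> 'a) set"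

definition update_A :: "('a \<Rightarrow> 'a) set \<Rightarrow> 'a update \<Rightarrow> bool" where
  "update_A F update \<longleftrightarrow> (\<forall>G g d. G \<subseteq> F \<longrightarrow> g \<in> F \<longrightarrow>
     {f \<in> F - G. f d = d \<and> f (g d) \<noteq> g d} \<subseteq> update G g d)"

definition update_B :: "('a \<Rightarrow> 'a) set \<Rightarrow> 'a update \<Rightarrow> bool" where
  "update_B F update \<longleftrightarrow> (\<forall>G g d. G \<subseteq> F \<longrightarrow> g \<in> F \<longrightarrow>
     g d = d \<longrightarrow> update G g d = {})"

definition update_C :: "('a \<Rightarrow> 'a) set \<Rightarrow> 'a update \<Rightarrow> bool" where
  "update_C F update \<longleftrightarrow> (\<forall>G g d. G \<subseteq> F \<longrightarrow> g \<in> F \<longrightarrow>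
     g (g d) \<noteq> g d \<longrightarrow> g \<in> update G g d)"

text \<open>
  A state is a pair of the current values of \<open>d\<close> and \<open>G\<close>, observed at the loop head.
  \<open>gi_step update s t\<close> means that the loop condition holds in \<open>s\<close> and that one execution of
  the loop body, for some choice of \<open>g\<close>, leads to \<open>t\<close>. The assignments are sequential:
  \<open>update\<close> is called with \<open>g\<close> already removed from \<open>G\<close>, but with the old value of \<open>d\<close>.
\<close>

type_synonym 'a gi_state = "'a \<times> ('a \<Rightarrow> 'a) set"

definition gi_init :: "('a::order_bot \<Rightarrow> 'a) set \<Rightarrow> 'a gi_state" where
  "gi_init F = (bot, F)"

definition gi_guard :: "'a::order_top gi_state \<Rightarrow> bool" where
  "gi_guard s \<longleftrightarrow> (case s of (d, G) \<Rightarrow> G \<noteq> {} \<and> d \<noteq> top)"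

inductive gi_step :: "'a::order_top update \<Rightarrow> 'a gi_state \<Rightarrow> 'a gi_state \<Rightarrow> bool"
  for update :: "'a update" where
  "gi_guard (d, G) \<Longrightarrow> g \<in> G \<Longrightarrow> G' = G - {g} \<Longrightarrow> G'' = G' \<union> update G' g d \<Longrightarrow> d' = g d \<Longrightarrow>
     gi_step update (d, G) (d', G'')"

end

theory Submission
  imports Defs
begin

text \<open>
  At the loop head every function in \<open>F - G\<close> fixes \<open>d\<close>, and \<open>d\<close> lies below every common
  fixpoint of \<open>F\<close>. Conditions A and C preserve the first property, monotonicity the second. So \<open>d\<close>
  is the least common fixpoint once \<open>G\<close> is empty; and if \<open>d\<close> reaches the top, it is a common
  fixpoint because the functions are inflationary. Each iteration either moves \<open>d\<close> strictly up or,
  by condition B, removes an element of \<open>G\<close>; this gives a lexicographic termination measure.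
\<close>

definition gi_invariant :: "('a::order \<Rightarrow> 'a) set \<Rightarrow> 'a gi_state \<Rightarrow> bool" where
  "gi_invariant F s \<longleftrightarrow> (case s of (d, G) \<Rightarrow>
     G \<subseteq> F \<and> (\<forall>f \<in> F - G. f d = d) \<and> (\<forall>y. common_fixpoint F y \<longrightarrow> d \<le> y))"

lemma gi_invariant_init: "gi_invariant F (gi_init F)"
  by (simp add: gi_invariant_def gi_init_def)

lemma gi_invariant_step:
  assumes mono: "\<And>f. f \<in> F \<Longrightarrow> mono f"
    and update_subset: "\<And>G g d. G \<subseteq> F \<Longrightarrow> g \<in> F \<Longrightarrow> update G g d \<subseteq> F"
    and A: "update_A F update"
    and C: "update_C F update"
    and step: "gi_step update s t"
    and inv: "gi_invariant F s"
  shows "gi_invariant F t"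
  using step
proof cases
  case (1 d G g G' G'' d')
  have GF: "G \<subseteq> F" and fixed: "\<And>f. f \<in> F \<Longrightarrow> f \<notin> G \<Longrightarrow> f d = d"
    and below: "\<And>y. common_fixpoint F y \<Longrightarrow> d \<le> y"
    using inv 1 by (auto simp: gi_invariant_def)
  have g: "g \<in> F" and G': "G' \<subseteq> F"
    using 1 GF by auto
  have "G'' \<subseteq> F"
    using 1 G' update_subset[OF G' g] by auto
  \<comment> \<open>The invariant says nothing about the chosen \<open>g\<close>, which was still in
    \<open>G\<close>; for it condition C is used contrapositively. Any other \<open>f\<close>
    outside \<open>G''\<close> was already outside \<open>G\<close>, so it fixes \<open>d\<close>,
    and A would have added it had it failed to fix \<open>g d\<close>.\<close>
  moreover have "f (g d) = g d" if f: "f \<in> F" "f \<notin> G''" for f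
  proof (cases "f = g")
    case True
    then show ?thesis
      using C G' g f 1 unfolding update_C_def by blast
  next
    case False
    then have "f \<in> F - G'" and "f d = d"
      using f 1 fixed by auto
    then show ?thesis
      using A G' g f 1 unfolding update_A_def by blast
  qed
  \<comment> \<open>Monotonicity gives \<open>g d \<le> g y = y\<close>.\<close>
  moreover have "g d \<le> y" if y: "common_fixpoint F y" for y
    using monoD[OF mono[OF g] below[OF y]] y g by (metis common_fixpoint_def)
  ultimately show ?thesis
    using 1 by (simp add: gi_invariant_def)
qed

text \<open>The first component counts the elements strictly above \<open>d\<close>, so it drops
  when \<open>d\<close> rises, however many functions \<open>update\<close> adds to
  \<open>G\<close>.\<close>

lemma gi_step_decreases:
  fixes F :: "('a::{finite, order_top} \<Rightarrow> 'a) set"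
  assumes infl: "\<And>f. f \<in> F \<Longrightarrow> inflationary f"
    and B: "update_B F update"
    and step: "gi_step update s t"
    and subset: "snd s \<subseteq> F"
  shows "(t, s) \<in> inv_image (less_than <*lex*> less_than)
    (\<lambda>(d, G). (card {x. d < x}, card G))"
  using step
proof cases
  case (1 d G g G' G'' d')
  have g: "g \<in> F" and G': "G' \<subseteq> F"
    using 1 subset by auto
  show ?thesis
  proof (cases "g d = d")
    case True
    then have "G'' = G - {g}"
      using B g G' 1 by (simp add: update_B_def)
    \<comment> \<open>\<open>G\<close> is finite because functions on a finite type form a finite
      type.\<close>
    then have "card G'' < card G"
      using 1 by (metis card_Diff1_less finite)
    then show ?thesis
      using 1 True by simp
  next
    case False
    then have "d < g d"
      using infl[OF g] by (simp add: inflationary_def order_less_le)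
    \<comment> \<open>The element \<open>g d\<close> itself witnesses strictness.\<close>
    then have "{x. g d < x} \<subset> {x. d < x}"
      by auto
    then have "card {x. g d < x} < card {x. d < x}"
      by (simp add: psubset_card_mono)
    then show ?thesis
      using 1 by simp
  qed
qed

lemma common_fixpoint_top:
  fixes F :: "('a::order_top \<Rightarrow> 'a) set"
  assumes "\<And>f. f \<in> F \<Longrightarrow> inflationary f"
  shows "common_fixpoint F top"
  using assms by (auto simp: common_fixpoint_def inflationary_def intro: top_le)

text \<open>At \<open>top\<close> the set \<open>G\<close> may be nonempty, so the fixpoint property
  comes from \<open>common_fixpoint_top\<close>; the invariant still supplies leastness.\<close>

lemma least_common_fixpoint_if_not_gi_guard:
  assumes "\<And>f. f \<in> F \<Longrightarrow> inflationary f"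
    and "gi_invariant F (d, G)"
    and "\<not> gi_guard (d, G)"
  shows "least_common_fixpoint F d"
  using assms common_fixpoint_top[of F]
  by (auto simp: gi_invariant_def gi_guard_def least_common_fixpoint_def common_fixpoint_def)

theorem theorem1:
  fixes F :: "('a::{finite, order_bot, order_top} \<Rightarrow> 'a) set"
    and update :: "'a update"
  assumes "finite F"
    and "\<And>f. f \<in> F \<Longrightarrow> inflationary f"
    and "\<And>f. f \<in> F \<Longrightarrow> mono f"
    and "\<And>G g d. G \<subseteq> F \<Longrightarrow> g \<in> F \<Longrightarrow> update G g d \<subseteq> F"
    and "update_A F update"
    and "update_B F update"
    and "update_C F update"
  shows "(\<nexists>s :: nat \<Rightarrow> 'a gi_state. s 0 = gi_init F \<and> (\<forall>i. gi_step update (s i) (s (Suc i)))) \<and>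
    (\<forall>d G. (gi_step update)\<^sup>*\<^sup>* (gi_init F) (d, G) \<and> \<not> gi_guard (d, G) \<longrightarrow>
       least_common_fixpoint F d)"
proof (intro conjI allI impI notI)
  note step_inv = gi_invariant_step[OF assms(3-5,7)]
  {
    assume "\<exists>s. s 0 = gi_init F \<and> (\<forall>i. gi_step update (s i) (s (Suc i)))"
    then obtain s where s0: "s 0 = gi_init F" and step: "\<And>i. gi_step update (s i) (s (Suc i))"
      by blast
    \<comment> \<open>Condition B constrains \<open>update\<close> only on subsets of
      \<open>F\<close>, so the descent needs \<open>G \<subseteq> F\<close> along the whole
      run.\<close>
    have inv: "gi_invariant F (s i)" for i
      by (induction i) (auto simp: s0 gi_invariant_init intro: step_inv step)
    have subset: "snd (s i) \<subseteq> F" for i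
      using inv[of i] by (auto simp: gi_invariant_def)
    let ?R = "inv_image (less_than <*lex*> less_than)
      (\<lambda>(d :: 'a, G :: ('a \<Rightarrow> 'a) set). (card {x. d < x}, card G))"
    have "(s (Suc i), s i) \<in> ?R" for i
      by (rule gi_step_decreases[OF assms(2,6) step subset])
    moreover have "wf ?R"
      by (intro wf_inv_image wf_lex_prod wf_less_than)
    ultimately show False
      unfolding wf_iff_no_infinite_down_chain by blast
  next
    fix d G
    assume run: "(gi_step update)\<^sup>*\<^sup>* (gi_init F) (d, G) \<and> \<not> gi_guard (d, G)"
    have "gi_invariant F t" if "(gi_step update)\<^sup>*\<^sup>* (gi_init F) t" for t
      using that by induction (auto simp: gi_invariant_init intro: step_inv)
    then show "least_common_fixpoint F d"
      using least_common_fixpoint_if_not_gi_guard[OF assms(2)] run by blast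
  }
qed

end
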